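(* Let $C$ and $Q$ be $n\times n$ matrices with entries in $A^{\mathbb C}$. Assume that for any two entries $\alpha,\beta$ of the matrices $C,Q$ (each of $\alpha,\beta$ may be an entry of either matrix, and $\alpha=\beta$ is allowed) one has $[\alpha,\bar\beta]=0$. Assume also that for all $i,j,k\in\{1,\dots,n\}$ $$[C_{ik},C_{jk}]=C_{ik}Q_{jk}-C_{jk}Q_{ik},\qquad [C_{ik},Q_{jk}]=[C_{jk},Q_{ik}],\qquad [Q_{ik},Q_{jk}]=0 .$$ (Only entries from the same column are related; no relation is imposed between entries from different columns.) Let $d_1,\dots,d_n$ be central elements of $A^{\mathbb C}$. Let $T$ be the $2n\times 2n$ block-diagonal matrix with $n$ diagonal $2\times2$ blocks, whose $m$-th block is $$\begin{pmatrix} d_{n+1-m}+\tfrac14 & \tfrac{i}{4}\\ \tfrac{i}{4} & d_{n+1-m}-\tfrac14\end{pmatrix},\qquad m=1,\dots,n .$$ Then $${\det}^{\mathrm{col}}\big(C^{\mathbb R}+Q^{\mathbb R}T\big)={\det}^{\mathrm{col}}\big(C+Q\,\mathrm{diag}(d_n,d_{n-1},\dots,d_1)\big)\;{\det}^{\mathrm{col}}\big(\bar C+\bar Q\,\mathrm{diag}(d_n,d_{n-1},\dots,d_1)\big).$$ The same identity holds if in $T$ every $\tfrac{i}{4}$ is replaced by $-\tfrac{i}{4}$ (the elements $d_j$ being left unchanged).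
   Context: Let $k$ be a field of characteristic different from $2$, $k[i]=k[t]/(t^2+1)$ with $i$ the class of $t$ (a formal imaginary unit; the case $k=\mathbb R$, $k[i]=\mathbb C$ is typical). $A$ is an associative unital (not necessarily commutative) $k$-algebra and $A^{\mathbb C}=A\otimes_k k[i]=A\oplus iA$. Every $c\in A^{\mathbb C}$ is uniquely $c=a+ib$ with $a,b\in A$; put $\mathrm{Re}(c)=a$, $\mathrm{Im}(c)=b$, $\bar c=a-ib$. For a matrix $M$, $\bar M$ is obtained by applying the bar entrywise. For an $n\times m$ matrix $M$ over $A^{\mathbb C}$, $M^{\mathbb R}$ is the $2n\times 2m$ matrix over $A$ obtained by replacing each entry $M_{ij}$ by the $2\times2$ block $\begin{pmatrix}\mathrm{Re}(M_{ij})&\mathrm{Im}(M_{ij})\\-\mathrm{Im}(M_{ij})&\mathrm{Re}(M_{ij})\end{pmatrix}$. The column-determinant of an $N\times N$ matrix $M$ over a not necessarily commutative ring is ${\det}^{\mathrm{col}}M=\sum_{\sigma\in S_N}\mathrm{sgn}(\sigma)\,M_{\sigma(1)1}M_{\sigma(2)2}\cdots M_{\sigma(N)N}$ (factors ordered by column). $[a,b]=ab-ba$. *)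

theory Defs
  imports "Jordan_Normal_Form.Matrix" "HOL-Combinatorics.Permutations"
begin

text \<open>
  Unital associative algebras over a field. The sort \<open>{ring, monoid_mult}\<close> is used rather than
  \<open>ring_1\<close>, because the latter excludes the zero algebra by requiring \<open>0 \<noteq> 1\<close>.
\<close>

locale unital_algebra = vector_space scale
  for scale :: "'k::field \<Rightarrow> 'a::{ring,monoid_mult} \<Rightarrow> 'a" +
  assumes scale_mult_left: "scale c x * y = scale c (x * y)"
    and scale_mult_right: "x * scale c y = scale c (x * y)"

text \<open>
  The complexification of an algebra \<open>A\<close> over \<open>k\<close>, i.e. the tensor product of \<open>A\<close> with
  \<open>k[t]/(t\<^sup>2+1)\<close>, in its direct sum form: \<open>Cplx a b\<close> stands for \<open>a + ib\<close>. The multiplication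
  does not depend on \<open>k\<close>.
\<close>

datatype 'a cplx = Cplx (re: 'a) (im: 'a)

instantiation cplx :: (ring) ring
begin

definition "0 = Cplx 0 0"
definition "x + y = Cplx (re x + re y) (im x + im y)"
definition "- x = Cplx (- re x) (- im x)"
definition "x - y = Cplx (re x - re y) (im x - im y)"
definition "x * y = Cplx (re x * re y - im x * im y) (re x * im y + im x * re y)"

instance
  by standard
    (simp_all add: zero_cplx_def plus_cplx_def uminus_cplx_def minus_cplx_def times_cplx_def
      algebra_simps)

end

instantiation cplx :: ("{ring,monoid_mult}") monoid_mult
begin

definition "1 = Cplx 1 0"

instance
  by standard (simp_all add: one_cplx_def times_cplx_def mult.assoc)

end

definition of_base :: "'a::zero \<Rightarrow> 'a cplx" where
  "of_base a = Cplx a 0"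

definition imag_unit :: "'a::{zero,one} cplx" where
  "imag_unit = Cplx 0 1"

definition bar :: "'a::uminus cplx \<Rightarrow> 'a cplx" where
  "bar c = Cplx (re c) (- im c)"

lemma cplx_eq_re_im:
  "c = of_base (re c) + imag_unit * of_base (im c)" for c :: "'a::{ring,monoid_mult} cplx"
  by (simp add: of_base_def imag_unit_def plus_cplx_def times_cplx_def)

lemma imag_unit_squared: "imag_unit * imag_unit = (- 1 :: 'a::{ring,monoid_mult} cplx)"
  by (simp add: imag_unit_def times_cplx_def one_cplx_def uminus_cplx_def)

lemma imag_unit_commute: "imag_unit * c = c * imag_unit" for c :: "'a::{ring,monoid_mult} cplx"
  by (simp add: imag_unit_def times_cplx_def)

lemma of_base_add: "of_base (a + b) = of_base a + of_base b" for a b :: "'a::ring"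
  by (simp add: of_base_def plus_cplx_def)

lemma of_base_mult: "of_base (a * b) = of_base a * of_base b" for a b :: "'a::ring"
  by (simp add: of_base_def times_cplx_def)

lemma of_base_one: "of_base 1 = (1 :: 'a::{ring,monoid_mult} cplx)"
  by (simp add: of_base_def one_cplx_def)

definition commutator :: "'a::ring \<Rightarrow> 'a \<Rightarrow> 'a" where
  "commutator a b = a * b - b * a"

definition central :: "'a::times \<Rightarrow> bool" where
  "central z \<longleftrightarrow> (\<forall>x. z * x = x * z)"

text \<open>
  The factors are multiplied in the order of the columns. The sign is a case distinction, since
  \<open>of_int\<close> is not available in the sort \<open>{ring, monoid_mult}\<close>.
\<close>

definition col_det :: "'a::{ring,monoid_mult} mat \<Rightarrow> 'a" where
  "col_det M = (\<Sum>\<sigma> | \<sigma> permutes {0..<dim_col M}.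
     let p = prod_list (map (\<lambda>j. M $$ (\<sigma> j, j)) [0..<dim_col M])
     in if evenperm \<sigma> then p else - p)"

text \<open>
  The \<open>2n \<times> 2m\<close> matrix made of the \<open>2 \<times> 2\<close> blocks \<open>B i j\<close> for \<open>i < n\<close> and \<open>j < m\<close>.
\<close>

definition mat_of_blocks2 :: "nat \<Rightarrow> nat \<Rightarrow> (nat \<Rightarrow> nat \<Rightarrow> 'a mat) \<Rightarrow> 'a mat" where
  "mat_of_blocks2 n m B =
     mat (2 * n) (2 * m) (\<lambda>(r, c). B (r div 2) (c div 2) $$ (r mod 2, c mod 2))"

definition realify :: "'a::uminus cplx mat \<Rightarrow> 'a mat" where
  "realify M = mat_of_blocks2 (dim_row M) (dim_col M)
     (\<lambda>i j. mat_of_rows_list 2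
        [[re (M $$ (i, j)), im (M $$ (i, j))],
         [- im (M $$ (i, j)), re (M $$ (i, j))]])"

text \<open>
  The block-diagonal matrix \<open>T\<close>; the parameter \<open>u\<close> is \<open>i\<close> or \<open>-i\<close>. Rows and columns are counted
  from 0, so the block with index \<open>m\<close> here is the \<open>(m+1)\<close>-st one and carries
  \<open>d\<^bsub>n+1-(m+1)\<^esub> = d\<^bsub>n-m\<^esub>\<close>; thus \<open>d\<close> is used at the indices \<open>1, \<dots>, n\<close>.
\<close>

definition shift_mat ::
  "('k::field \<Rightarrow> 'a::{ring,monoid_mult} \<Rightarrow> 'a) \<Rightarrow> 'a cplx \<Rightarrow> nat \<Rightarrow> (nat \<Rightarrow> 'a cplx) \<Rightarrow> 'a cplx mat"
  where
  "shift_mat scale u n d = (let q = of_base (scale (1 / 4) 1) in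
     mat_of_blocks2 n n (\<lambda>m m'.
       if m = m' then mat_of_rows_list 2 [[d (n - m) + q, u * q], [u * q, d (n - m) - q]]
       else 0\<^sub>m 2 2))"

end

theory Submission
  imports Defs
begin

text \<open>
  Let \<open>u = i\<close> first. Conjugates are written \<open>C', Q'\<close>. Replacing in
  \<open>C\<^sup>\<real> + Q\<^sup>\<real> T\<close> each pair \<open>(r\<^sub>1, r\<^sub>2)\<close> of rows by \<open>(r\<^sub>1 - u r\<^sub>2, r\<^sub>1 + u r\<^sub>2)\<close>
  multiplies the column-determinant by the central invertible element \<open>(2u)\<^sup>n\<close>
  (\<open>cdet_row_pairs\<close>). Afterwards the columns come in pairs, one for each column of \<open>C\<close> and with
  one of the central elements as \<open>d\<close>, namely \<open>(X + Y, uY - uX')\<close> with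
  \<open>X = C + Q(d + 1/2)\<close>, \<open>X' = C + Q(d - 1/2)\<close> and \<open>Y = C' + Q'd\<close>,
  where \<open>X, X'\<close> are supported on the even rows and \<open>Y\<close> on the odd rows (rows and columns are
  counted from 0).

  A column-determinant depends on two adjacent columns \<open>f, g\<close> only through the antisymmetrized
  products \<open>f\<^sub>r g\<^sub>s - f\<^sub>s g\<^sub>r\<close> (\<open>cdet_adjacent_columns\<close>). The three relations between the entries of
  a column of \<open>C\<close> and \<open>Q\<close> make \<open>X\<^sub>r X'\<^sub>s\<close> symmetric in \<open>r, s\<close>
  (\<open>shifted_columns_symmetric\<close>); this is the reason for the shift by \<open>1/2\<close>. As the entries of
  \<open>X, X'\<close> commute with those of \<open>Y\<close> and \<open>X + X' = 2Z\<close> for \<open>Z = C + Qd\<close>, the pair of columns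
  contributes \<open>2u (Z, Y) + u (Y, Y)\<close>. There are only \<open>n\<close> odd rows, so a term in which some pair is
  \<open>(Y, Y)\<close> contains more than \<open>n\<close> columns supported on them and vanishes. What remains is
  \<open>(2u)\<^sup>n\<close> times the column-determinant with columns \<open>Z\<^sub>1, Y\<^sub>1, Z\<^sub>2, Y\<^sub>2, \<dots>\<close>
  (\<open>cdet_column_pairs\<close>). In it only the permutations preserving parity contribute, and these are
  the pairs of permutations of \<open>n\<close> letters, so that it equals \<open>det Z det Y\<close>
  (\<open>cdet_interleave\<close>). Cancelling \<open>(2u)\<^sup>n\<close> gives the claim for \<open>u = i\<close>. For \<open>u = -i\<close> the same
  argument applies with \<open>C, Q\<close> and \<open>C', Q'\<close> exchanged, because the conjugates satisfy the same
  relations. It gives \<open>det Y det Z\<close>, and the two factors commute.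
\<close>

section \<open>Column-determinants of functions of two indices\<close>

text \<open>
  The column-determinant of the \<open>N \<times> N\<close> matrix with entries \<open>M i j\<close>. A function of row and column
  is more convenient than a matrix for changing single rows and columns.
\<close>

definition cdet :: "nat \<Rightarrow> (nat \<Rightarrow> nat \<Rightarrow> 'a) \<Rightarrow> 'a::{ring,monoid_mult}" where
  "cdet N M = (\<Sum>\<sigma> | \<sigma> permutes {0..<N}.
     if evenperm \<sigma> then prod_list (map (\<lambda>j. M (\<sigma> j) j) [0..<N])
     else - prod_list (map (\<lambda>j. M (\<sigma> j) j) [0..<N]))"

lemma col_det_eq_cdet: "col_det M = cdet (dim_col M) (\<lambda>i j. M $$ (i, j))"
  by (simp add: col_det_def cdet_def Let_def)

lemma cdet_cong:
  assumes "\<And>i j. i < N \<Longrightarrow> j < N \<Longrightarrow> M i j = M' i j"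
  shows "cdet N M = cdet N M'"
proof -
  have "map (\<lambda>j. M (\<sigma> j) j) [0..<N] = map (\<lambda>j. M' (\<sigma> j) j) [0..<N]"
    if "\<sigma> permutes {0..<N}" for \<sigma>
  proof (rule map_cong[OF refl])
    fix j assume "j \<in> set [0..<N]"
    then show "M (\<sigma> j) j = M' (\<sigma> j) j"
      using permutes_in_image[OF that, of j] by (intro assms) simp_all
  qed
  then show ?thesis
    unfolding cdet_def by (intro sum.cong refl) (simp only: mem_Collect_eq)
qed

lemma upt_split_at:
  assumes "j < N"
  shows "[0..<N] = [0..<j] @ j # [Suc j..<N]"
  using assms upt_add_eq_append[of 0 j "N - j"] upt_conv_Cons[of j N] by simp

lemma prod_list_linear_factor:
  fixes c :: "'a::{ring,monoid_mult}"
  assumes "j < N" "central c" "f j = c * g j + h j"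
    and "\<And>i. i < N \<Longrightarrow> i \<noteq> j \<Longrightarrow> f i = g i" "\<And>i. i < N \<Longrightarrow> i \<noteq> j \<Longrightarrow> f i = h i"
  shows "prod_list (map f [0..<N]) = c * prod_list (map g [0..<N]) + prod_list (map h [0..<N])"
proof -
  let ?L = "prod_list (map f [0..<j])" and ?R = "prod_list (map f [Suc j..<N])"
  have g: "prod_list (map g [0..<N]) = ?L * (g j * ?R)"
    and h: "prod_list (map h [0..<N]) = ?L * (h j * ?R)"
    and f: "prod_list (map f [0..<N]) = ?L * (f j * ?R)"
    using assms(1,4,5) unfolding upt_split_at[OF assms(1)]
    by (auto intro!: arg_cong2[of _ _ _ _ "(*)"] arg_cong[of _ _ prod_list])
  have "c * ?L = ?L * c"
    using assms(2) by (simp add: central_def)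
  then have "?L * (c * x) = c * (?L * x)" for x
    by (metis mult.assoc)
  then show ?thesis
    unfolding f g h assms(3) by (simp add: distrib_left distrib_right mult.assoc)
qed

text \<open>
  Linearity in a row holds although the row entry stands in the middle of each product, because the
  coefficient is central.
\<close>

lemma cdet_row_linear:
  fixes c :: "'a::{ring,monoid_mult}"
  assumes "a < N" "central c"
  shows "cdet N (M(a := \<lambda>j. c * v j + w j)) = c * cdet N (M(a := v)) + cdet N (M(a := w))"
proof -
  have "prod_list (map (\<lambda>j. (M(a := \<lambda>j. c * v j + w j)) (\<sigma> j) j) [0..<N]) =
      c * prod_list (map (\<lambda>j. (M(a := v)) (\<sigma> j) j) [0..<N]) +
      prod_list (map (\<lambda>j. (M(a := w)) (\<sigma> j) j) [0..<N])"
    if \<sigma>: "\<sigma> permutes {0..<N}" for \<sigma>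
  proof -
    have "\<sigma> i \<noteq> a" if "i \<noteq> inv_into UNIV \<sigma> a" for i
      using permutes_inverses[OF \<sigma>] permutes_in_image[OF permutes_inv[OF \<sigma>], of a] assms(1) that
      by auto
    moreover have "inv_into UNIV \<sigma> a < N" "\<sigma> (inv_into UNIV \<sigma> a) = a"
      using permutes_inverses[OF \<sigma>] permutes_in_image[OF permutes_inv[OF \<sigma>], of a] assms(1)
      by auto
    ultimately show ?thesis
      by (intro prod_list_linear_factor[where j = "inv_into UNIV \<sigma> a"] assms) auto
  qed
  then show ?thesis
    unfolding cdet_def sum_distrib_left sum.distrib[symmetric]
    by (intro sum.cong) auto
qed

text \<open>
  Any sign-reversing bijection pairs the even permutations with the odd ones. This gives the
  vanishing results below without dividing by 2.
\<close>

lemma cdet_eq_sum_evenperm: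
  fixes M :: "nat \<Rightarrow> nat \<Rightarrow> 'a::{ring,monoid_mult}"
  assumes "bij_betw \<phi> {\<sigma>. \<sigma> permutes {0..<N} \<and> evenperm \<sigma>}
      {\<sigma>. \<sigma> permutes {0..<N} \<and> \<not> evenperm \<sigma>}"
  shows "cdet N M = (\<Sum>\<sigma> | \<sigma> permutes {0..<N} \<and> evenperm \<sigma>.
      prod_list (map (\<lambda>j. M (\<sigma> j) j) [0..<N]) - prod_list (map (\<lambda>j. M (\<phi> \<sigma> j) j) [0..<N]))"
proof -
  let ?p = "\<lambda>\<sigma>. prod_list (map (\<lambda>j. M (\<sigma> j) j) [0..<N])"
  let ?E = "{\<sigma>. \<sigma> permutes {0..<N} \<and> evenperm \<sigma>}"
  let ?O = "{\<sigma>. \<sigma> permutes {0..<N} \<and> \<not> evenperm \<sigma>}"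
  have fin: "finite {\<sigma>. \<sigma> permutes {0..<N}}"
    by (simp add: finite_permutations)
  have "{\<sigma>. \<sigma> permutes {0..<N}} = ?E \<union> ?O" by auto
  then have "cdet N M = (\<Sum>\<sigma>\<in>?E \<union> ?O. if evenperm \<sigma> then ?p \<sigma> else - ?p \<sigma>)"
    unfolding cdet_def by (rule sum.cong) (rule refl)
  also have "\<dots> = (\<Sum>\<sigma>\<in>?E. if evenperm \<sigma> then ?p \<sigma> else - ?p \<sigma>) +
      (\<Sum>\<sigma>\<in>?O. if evenperm \<sigma> then ?p \<sigma> else - ?p \<sigma>)"
  proof (rule sum.union_disjoint)
    show "finite ?E" "finite ?O"
      by (rule finite_subset[OF _ fin], blast)+
  qed blast
  also have "(\<Sum>\<sigma>\<in>?E. if evenperm \<sigma> then ?p \<sigma> else - ?p \<sigma>) = (\<Sum>\<sigma>\<in>?E. ?p \<sigma>)"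
    by (rule sum.cong) auto
  also have "(\<Sum>\<sigma>\<in>?O. if evenperm \<sigma> then ?p \<sigma> else - ?p \<sigma>) = (\<Sum>\<sigma>\<in>?O. - ?p \<sigma>)"
    by (rule sum.cong) auto
  also have "(\<Sum>\<sigma>\<in>?O. - ?p \<sigma>) = (\<Sum>\<sigma>\<in>?E. - ?p (\<phi> \<sigma>))"
    by (rule sum.reindex_bij_betw[OF assms, symmetric])
  finally show ?thesis
    by (simp add: sum_negf sum_subtractf)
qed

lemma bij_betw_evenperm_transpose:
  fixes a b N :: nat
  assumes "a < N" "b < N" "a \<noteq> b"
  shows "bij_betw (\<lambda>\<sigma>. transpose a b \<circ> \<sigma>) {\<sigma>. \<sigma> permutes {0..<N} \<and> evenperm \<sigma>}
      {\<sigma>. \<sigma> permutes {0..<N} \<and> \<not> evenperm \<sigma>}"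
    and "bij_betw (\<lambda>\<sigma>. \<sigma> \<circ> transpose a b) {\<sigma>. \<sigma> permutes {0..<N} \<and> evenperm \<sigma>}
      {\<sigma>. \<sigma> permutes {0..<N} \<and> \<not> evenperm \<sigma>}"
proof -
  have t: "transpose a b permutes {0..<N}"
    using assms by (intro permutes_swap_id) auto
  have p: "permutation \<sigma>" if "\<sigma> permutes {0..<N}" for \<sigma>
    using that permutation_permutes by blast
  have pe: "transpose a b \<circ> \<sigma> permutes {0..<N}" "\<sigma> \<circ> transpose a b permutes {0..<N}"
    "evenperm (transpose a b \<circ> \<sigma>) \<longleftrightarrow> \<not> evenperm \<sigma>"
    "evenperm (\<sigma> \<circ> transpose a b) \<longleftrightarrow> \<not> evenperm \<sigma>"
    if "\<sigma> permutes {0..<N}" for \<sigma>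
    using that t assms(3) p[OF that] p[OF t]
    by (auto simp: permutes_compose evenperm_comp evenperm_swap)
  have tt: "transpose a b \<circ> (transpose a b \<circ> \<sigma>) = \<sigma>"
    "\<sigma> \<circ> transpose a b \<circ> transpose a b = \<sigma>" for \<sigma> :: "nat \<Rightarrow> nat"
    by (simp_all add: fun_eq_iff)
  show "bij_betw (\<lambda>\<sigma>. transpose a b \<circ> \<sigma>) {\<sigma>. \<sigma> permutes {0..<N} \<and> evenperm \<sigma>}
      {\<sigma>. \<sigma> permutes {0..<N} \<and> \<not> evenperm \<sigma>}"
    by (rule bij_betw_byWitness[where f' = "\<lambda>\<sigma>. transpose a b \<circ> \<sigma>"]) (auto simp: pe tt)
  show "bij_betw (\<lambda>\<sigma>. \<sigma> \<circ> transpose a b) {\<sigma>. \<sigma> permutes {0..<N} \<and> evenperm \<sigma>}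
      {\<sigma>. \<sigma> permutes {0..<N} \<and> \<not> evenperm \<sigma>}"
    by (rule bij_betw_byWitness[where f' = "\<lambda>\<sigma>. \<sigma> \<circ> transpose a b"]) (auto simp: pe tt)
qed

text \<open>
  The column-determinant over a noncommutative ring is alternating in its rows, but not in its
  columns.
\<close>

lemma cdet_equal_rows:
  fixes M :: "nat \<Rightarrow> nat \<Rightarrow> 'a::{ring,monoid_mult}"
  assumes "a < N" "b < N" "a \<noteq> b" "M a = M b"
  shows "cdet N M = 0"
proof -
  have "M ((transpose a b \<circ> \<sigma>) j) = M (\<sigma> j)" for \<sigma> :: "nat \<Rightarrow> nat" and j
    using assms(4) by (auto simp: transpose_def)
  then show ?thesis
    unfolding cdet_eq_sum_evenperm[OF bij_betw_evenperm_transpose(1)[OF assms(1-3)]] by simp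
qed

lemma cdet_row_scale:
  fixes c :: "'a::{ring,monoid_mult}"
  assumes "a < N" "central c"
  shows "cdet N (M(a := \<lambda>j. c * M a j)) = c * cdet N M"
proof -
  have "cdet N (M(a := \<lambda>j. 0 :: 'a)) = 0"
    using cdet_row_linear[of a N 1 M "\<lambda>_. 0" "\<lambda>_. 0"] assms(1)
    by (simp add: central_def)
  then show ?thesis
    using cdet_row_linear[OF assms, of M "M a" "\<lambda>_. 0"] by simp
qed

lemma cdet_row_add:
  fixes c :: "'a::{ring,monoid_mult}"
  assumes "a < N" "b < N" "a \<noteq> b" "central c"
  shows "cdet N (M(a := \<lambda>j. c * M b j + M a j)) = cdet N M"
  using cdet_row_linear[OF assms(1,4), of M "M b" "M a"] assms
    cdet_equal_rows[OF assms(1-3), of "M(a := M b)"] by simp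

text \<open>
  For columns only the following survives: adjacent factors \<open>f\<close> and \<open>g\<close> enter through
  \<open>f\<^sub>r g\<^sub>s - f\<^sub>s g\<^sub>r\<close> alone, and linearly. Hence a linear relation between the antisymmetrized
  products of three pairs of columns carries over to the column-determinants.
\<close>

lemma cdet_adjacent_columns:
  fixes M M1 M2 :: "nat \<Rightarrow> nat \<Rightarrow> 'a::{ring,monoid_mult}"
  assumes j: "Suc j < N" and c: "central c1" "central c2"
    and eq1: "\<And>r k. k \<noteq> j \<Longrightarrow> k \<noteq> Suc j \<Longrightarrow> M1 r k = M r k"
    and eq2: "\<And>r k. k \<noteq> j \<Longrightarrow> k \<noteq> Suc j \<Longrightarrow> M2 r k = M r k"
    and alt: "\<And>r s. r < N \<Longrightarrow> s < N \<Longrightarrow> M r j * M s (Suc j) - M s j * M r (Suc j) =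
      c1 * (M1 r j * M1 s (Suc j) - M1 s j * M1 r (Suc j)) +
      c2 * (M2 r j * M2 s (Suc j) - M2 s j * M2 r (Suc j))"
  shows "cdet N M = c1 * cdet N M1 + c2 * cdet N M2"
proof -
  define D where "D = (\<lambda>(M :: nat \<Rightarrow> nat \<Rightarrow> 'a) (\<sigma> :: nat \<Rightarrow> nat).
    prod_list (map (\<lambda>k. M (\<sigma> k) k) [0..<N]) -
    prod_list (map (\<lambda>k. M ((\<sigma> \<circ> transpose j (Suc j)) k) k) [0..<N]))"
  have split: "[0..<N] = [0..<j] @ j # Suc j # [Suc (Suc j)..<N]"
    using upt_split_at[of j N] upt_conv_Cons[of "Suc j" N] j by simp
  define L where "L = (\<lambda>\<sigma> :: nat \<Rightarrow> nat. prod_list (map (\<lambda>k. M (\<sigma> k) k) [0..<j]))"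
  define R where "R = (\<lambda>\<sigma> :: nat \<Rightarrow> nat. prod_list (map (\<lambda>k. M (\<sigma> k) k) [Suc (Suc j)..<N]))"
  \<comment> \<open>\<open>L\<close> and \<open>R\<close> collect the factors to the left and to the right of the two columns.\<close>
  have D: "D M' \<sigma> = L \<sigma> * (M' (\<sigma> j) j * M' (\<sigma> (Suc j)) (Suc j) -
      M' (\<sigma> (Suc j)) j * M' (\<sigma> j) (Suc j)) * R \<sigma>"
    if "\<And>r k. k \<noteq> j \<Longrightarrow> k \<noteq> Suc j \<Longrightarrow> M' r k = M r k" for M' \<sigma>
  proof -
    have maps: "map (\<lambda>k. M' (\<sigma> k) k) [0..<j] = map (\<lambda>k. M (\<sigma> k) k) [0..<j]"
      "map (\<lambda>k. M' ((\<sigma> \<circ> transpose j (Suc j)) k) k) [0..<j] = map (\<lambda>k. M (\<sigma> k) k) [0..<j]"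
      "map (\<lambda>k. M' (\<sigma> k) k) [Suc (Suc j)..<N] = map (\<lambda>k. M (\<sigma> k) k) [Suc (Suc j)..<N]"
      "map (\<lambda>k. M' ((\<sigma> \<circ> transpose j (Suc j)) k) k) [Suc (Suc j)..<N] =
        map (\<lambda>k. M (\<sigma> k) k) [Suc (Suc j)..<N]"
      by (auto simp: that transpose_def)
    then show ?thesis
      unfolding D_def split map_append list.map(2) maps prod_list.append prod_list.Cons L_def R_def
      by (simp add: mult.assoc right_diff_distrib left_diff_distrib)
  qed
  have cdet: "cdet N M' = (\<Sum>\<sigma> | \<sigma> permutes {0..<N} \<and> evenperm \<sigma>. D M' \<sigma>)" for M'
    unfolding D_def
    by (rule cdet_eq_sum_evenperm[OF bij_betw_evenperm_transpose(2)]) (use j in auto)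
  have "D M \<sigma> = c1 * D M1 \<sigma> + c2 * D M2 \<sigma>" if "\<sigma> permutes {0..<N}" for \<sigma>
  proof -
    have lt: "\<sigma> j < N" "\<sigma> (Suc j) < N"
      using permutes_in_image[OF that, of j] permutes_in_image[OF that, of "Suc j"] j by auto
    have "c1 * x = x * c1" "c2 * x = x * c2" for x
      using c by (auto simp: central_def)
    then have "L \<sigma> * (c1 * x) = c1 * (L \<sigma> * x)" "L \<sigma> * (c2 * x) = c2 * (L \<sigma> * x)" for x
      by (metis mult.assoc)+
    moreover have "D M \<sigma> = L \<sigma> * (M (\<sigma> j) j * M (\<sigma> (Suc j)) (Suc j) -
        M (\<sigma> (Suc j)) j * M (\<sigma> j) (Suc j)) * R \<sigma>"
      by (rule D) simp
    moreover have "D M1 \<sigma> = L \<sigma> * (M1 (\<sigma> j) j * M1 (\<sigma> (Suc j)) (Suc j) -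
        M1 (\<sigma> (Suc j)) j * M1 (\<sigma> j) (Suc j)) * R \<sigma>"
      by (rule D) (rule eq1)
    moreover have "D M2 \<sigma> = L \<sigma> * (M2 (\<sigma> j) j * M2 (\<sigma> (Suc j)) (Suc j) -
        M2 (\<sigma> (Suc j)) j * M2 (\<sigma> j) (Suc j)) * R \<sigma>"
      by (rule D) (rule eq2)
    ultimately show ?thesis
      unfolding alt[OF lt] by (simp only: distrib_left distrib_right mult.assoc)
  qed
  then show ?thesis
    unfolding cdet sum_distrib_left sum.distrib[symmetric] by (intro sum.cong) auto
qed

lemma cdet_row_pair:
  fixes u :: "'a::{ring,monoid_mult}"
  assumes "a < N" "b < N" "a \<noteq> b" and u: "\<And>x. u * x = x * u"
  shows "cdet N (M(a := \<lambda>j. M a j - u * M b j, b := \<lambda>j. M a j + u * M b j)) =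
    (u + u) * cdet N M"
proof -
  \<comment> \<open>The matrix \<open>(1, -u; 1, u)\<close> is a product of elementary ones: \<open>r\<^sub>1 + u r\<^sub>2 = (r\<^sub>1 - u r\<^sub>2) + 2u r\<^sub>2\<close>.\<close>
  define M1 where "M1 = M(a := \<lambda>j. (- u) * M b j + M a j)"
  define M2 where "M2 = M1(b := \<lambda>j. (u + u) * M1 b j)"
  have "M(a := \<lambda>j. M a j - u * M b j, b := \<lambda>j. M a j + u * M b j) =
      M2(b := \<lambda>j. 1 * M2 a j + M2 b j)"
    using assms(3) by (auto simp: M1_def M2_def fun_eq_iff algebra_simps)
  then have "cdet N (M(a := \<lambda>j. M a j - u * M b j, b := \<lambda>j. M a j + u * M b j)) =
      cdet N (M2(b := \<lambda>j. 1 * M2 a j + M2 b j))"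
    by (rule arg_cong)
  also have "\<dots> = cdet N M2"
    by (rule cdet_row_add) (use assms(1-3) in \<open>simp_all add: central_def\<close>)
  also have "\<dots> = (u + u) * cdet N M1"
    unfolding M2_def
    by (rule cdet_row_scale[OF assms(2)]) (simp add: central_def distrib_left distrib_right u)
  also have "cdet N M1 = cdet N M"
    unfolding M1_def
    by (rule cdet_row_add[OF assms(1-3)]) (simp add: central_def u)
  finally show ?thesis .
qed

lemma cdet_row_pairs:
  fixes u :: "'a::{ring,monoid_mult}"
  assumes u: "\<And>x. u * x = x * u"
  shows "cdet (2 * n) (\<lambda>r j. if even r then M r j - u * M (Suc r) j
      else M (r - 1) j + u * M r j) = (u + u) ^ n * cdet (2 * n) M"
proof -
  \<comment> \<open>In \<open>P k\<close> the first \<open>k\<close> pairs of rows are replaced.\<close>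
  define P where "P = (\<lambda>k r j. if r < 2 * k then
      (if even r then M r j - u * M (Suc r) j else M (r - 1) j + u * M r j) else M r j)"
  have "cdet (2 * n) (P k) = (u + u) ^ k * cdet (2 * n) M" if "k \<le> n" for k
    using that
  proof (induction k)
    case 0
    then show ?case by (simp add: P_def)
  next
    case (Suc k)
    have "P (Suc k) = (P k)(2 * k := \<lambda>j. P k (2 * k) j - u * P k (Suc (2 * k)) j,
        Suc (2 * k) := \<lambda>j. P k (2 * k) j + u * P k (Suc (2 * k)) j)"
      by (auto simp: fun_eq_iff P_def less_Suc_eq)
    then have "cdet (2 * n) (P (Suc k)) = (u + u) * cdet (2 * n) (P k)"
      using Suc.prems cdet_row_pair[OF _ _ _ u, of "2 * k" "2 * n" "Suc (2 * k)" "P k"] by simp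
    then show ?case
      using Suc by (simp add: mult.assoc)
  qed
  from this[of n] have "cdet (2 * n) (P n) = (u + u) ^ n * cdet (2 * n) M" by simp
  moreover have "cdet (2 * n) (P n) = cdet (2 * n) (\<lambda>r j. if even r then M r j - u * M (Suc r) j
      else M (r - 1) j + u * M r j)"
    by (rule cdet_cong) (simp add: P_def)
  ultimately show ?thesis by simp
qed

lemma prod_list_commute:
  fixes x :: "'a::monoid_mult"
  assumes "\<And>y. y \<in> set ys \<Longrightarrow> x * y = y * x"
  shows "x * prod_list ys = prod_list ys * x"
  using assms
proof (induction ys)
  case (Cons y ys)
  have "x * prod_list (y # ys) = y * (x * prod_list ys)"
    using Cons.prems[of y] by (simp add: mult.assoc[symmetric])
  also have "x * prod_list ys = prod_list ys * x"
    using Cons by simp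
  finally show ?case by (simp add: mult.assoc)
qed simp

lemma commute_cdet:
  fixes x :: "'a::{ring,monoid_mult}"
  assumes "\<And>i j. i < n \<Longrightarrow> j < n \<Longrightarrow> x * M i j = M i j * x"
  shows "x * cdet n M = cdet n M * x"
  unfolding cdet_def sum_distrib_left sum_distrib_right
proof (rule sum.cong[OF refl])
  fix \<sigma> assume "\<sigma> \<in> {\<sigma>. \<sigma> permutes {0..<n}}"
  then have "\<sigma> j < n" if "j < n" for j
    using permutes_in_image[of \<sigma> "{0..<n}" j] that by simp
  then have "x * prod_list (map (\<lambda>j. M (\<sigma> j) j) [0..<n]) =
      prod_list (map (\<lambda>j. M (\<sigma> j) j) [0..<n]) * x"
    by (intro prod_list_commute) (use assms in auto)
  then show "x * (if evenperm \<sigma> then prod_list (map (\<lambda>j. M (\<sigma> j) j) [0..<n])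
        else - prod_list (map (\<lambda>j. M (\<sigma> j) j) [0..<n])) =
      (if evenperm \<sigma> then prod_list (map (\<lambda>j. M (\<sigma> j) j) [0..<n])
        else - prod_list (map (\<lambda>j. M (\<sigma> j) j) [0..<n])) * x"
    by simp
qed

lemma cdet_commute:
  fixes M M' :: "nat \<Rightarrow> nat \<Rightarrow> 'a::{ring,monoid_mult}"
  assumes "\<And>i j k l. i < n \<Longrightarrow> j < n \<Longrightarrow> k < n \<Longrightarrow> l < n \<Longrightarrow> M i j * M' k l = M' k l * M i j"
  shows "cdet n M * cdet n M' = cdet n M' * cdet n M"
proof (rule commute_cdet)
  fix k l assume "k < n" "l < n"
  then show "cdet n M * M' k l = M' k l * cdet n M"
    by (intro commute_cdet[symmetric]) (use assms in auto)
qed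

section \<open>Interleaved matrices\<close>

lemma prod_list_interleave:
  fixes z y :: "nat \<Rightarrow> 'a::monoid_mult"
  assumes "\<And>i j. i < n \<Longrightarrow> j < n \<Longrightarrow> z i * y j = y j * z i"
  shows "prod_list (map (\<lambda>c. if even c then z (c div 2) else y (c div 2)) [0..<2 * n]) =
    prod_list (map z [0..<n]) * prod_list (map y [0..<n])"
  using assms
proof (induction n)
  case 0
  then show ?case by simp
next
  case (Suc n)
  let ?Z = "prod_list (map z [0..<n])" and ?Y = "prod_list (map y [0..<n])"
  have comm: "z n * ?Y = ?Y * z n"
    by (rule prod_list_commute) (use Suc.prems in auto)
  have "prod_list (map (\<lambda>c. if even c then z (c div 2) else y (c div 2)) [0..<2 * Suc n]) =
      ?Z * ?Y * z n * y n"
    using Suc by (simp add: mult.assoc)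
  also have "\<dots> = ?Z * z n * (?Y * y n)"
    using comm by (simp add: mult.assoc[symmetric]) (simp add: mult.assoc)
  finally show ?case by simp
qed

lemma prod_list_zero_factor:
  fixes f :: "nat \<Rightarrow> 'a::{ring,monoid_mult}"
  assumes "j < N" "f j = 0"
  shows "prod_list (map f [0..<N]) = 0"
  using upt_split_at[OF assms(1)] assms(2) by simp

text \<open>
  The permutation of \<open>{0..<2 * n}\<close> which acts as \<open>\<tau>\<close> on the even and as \<open>\<rho>\<close> on the odd numbers.
\<close>

definition interleave_perm :: "nat \<Rightarrow> (nat \<Rightarrow> nat) \<Rightarrow> (nat \<Rightarrow> nat) \<Rightarrow> nat \<Rightarrow> nat" where
  "interleave_perm n \<tau> \<rho> = map_permutation {0..<n} (\<lambda>i. 2 * i) \<tau> \<circ>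
     map_permutation {0..<n} (\<lambda>i. Suc (2 * i)) \<rho>"

lemma interleave_perm:
  fixes \<tau> \<rho> :: "nat \<Rightarrow> nat"
  assumes "\<tau> permutes {0..<n}" "\<rho> permutes {0..<n}"
  shows "interleave_perm n \<tau> \<rho> permutes {0..<2 * n}"
    and "evenperm (interleave_perm n \<tau> \<rho>) \<longleftrightarrow> evenperm \<tau> = evenperm \<rho>"
    and "i < n \<Longrightarrow> interleave_perm n \<tau> \<rho> (2 * i) = 2 * \<tau> i"
    and "i < n \<Longrightarrow> interleave_perm n \<tau> \<rho> (Suc (2 * i)) = Suc (2 * \<rho> i)"
proof -
  let ?e = "\<lambda>i. 2 * i :: nat" and ?o = "\<lambda>i. Suc (2 * i)"
  have inj: "inj_on ?e {0..<n}" "inj_on ?o {0..<n}"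
    by (auto simp: inj_on_def)
  have E: "map_permutation {0..<n} ?e \<tau> permutes ?e ` {0..<n}"
    and O: "map_permutation {0..<n} ?o \<rho> permutes ?o ` {0..<n}"
    using assms inj by (auto intro!: map_permutation_permutes simp: bij_betw_def)
  have E': "map_permutation {0..<n} ?e \<tau> permutes {0..<2 * n}"
    and O': "map_permutation {0..<n} ?o \<rho> permutes {0..<2 * n}"
    by (rule permutes_subset[OF E], force, rule permutes_subset[OF O], force)
  show "interleave_perm n \<tau> \<rho> permutes {0..<2 * n}"
    unfolding interleave_perm_def by (rule permutes_compose[OF O' E'])
  have p: "permutation (map_permutation {0..<n} ?e \<tau>)" "permutation (map_permutation {0..<n} ?o \<rho>)"
    using E' O' permutation_permutes by blast+
  show "evenperm (interleave_perm n \<tau> \<rho>) \<longleftrightarrow> evenperm \<tau> = evenperm \<rho>"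
    unfolding interleave_perm_def evenperm_comp[OF p]
    using evenperm_map_permutation[OF inj(1) assms(1)] evenperm_map_permutation[OF inj(2) assms(2)]
    by simp
  have odd_fix: "map_permutation {0..<n} ?o \<rho> (2 * i) = 2 * i" for i
    by (rule permutes_not_in[OF O]) (auto, presburger)
  have even_fix: "map_permutation {0..<n} ?e \<tau> (Suc (2 * i)) = Suc (2 * i)" for i
    by (rule permutes_not_in[OF E]) (auto, presburger)
  show "i < n \<Longrightarrow> interleave_perm n \<tau> \<rho> (2 * i) = 2 * \<tau> i"
    unfolding interleave_perm_def o_apply odd_fix
    by (rule map_permutation_apply[OF inj(1)]) simp
  show "i < n \<Longrightarrow> interleave_perm n \<tau> \<rho> (Suc (2 * i)) = Suc (2 * \<rho> i)"
    unfolding interleave_perm_def o_apply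
    using map_permutation_apply[OF inj(2), of i \<rho>] by (simp add: even_fix)
qed

text \<open>
  The two components of the inverse of \<open>interleave_perm\<close>.
\<close>

lemma permutes_deinterleave:
  assumes \<sigma>: "\<sigma> permutes {0..<2 * n}" and par: "\<And>c. c < 2 * n \<Longrightarrow> even (\<sigma> c) = even c"
  shows "(\<lambda>i. \<sigma> (2 * i) div 2) permutes {0..<n}"
    and "(\<lambda>i. \<sigma> (Suc (2 * i)) div 2) permutes {0..<n}"
proof -
  have lt: "\<sigma> c div 2 < n" if "c < 2 * n" for c
    using permutes_in_image[OF \<sigma>, of c] that by auto
  have fixed: "\<sigma> c = c" if "\<not> c < 2 * n" for c
    using permutes_not_in[OF \<sigma>] that by simp
  have inj: "c = c'" if "\<sigma> c div 2 = \<sigma> c' div 2" "c < 2 * n" "c' < 2 * n" "even c = even c'" for c c'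
  proof -
    have "even (\<sigma> c) = even (\<sigma> c')" using that par by simp
    with that(1) have "\<sigma> c = \<sigma> c'"
      by (metis dvd_div_mult_self odd_two_times_div_two_succ)
    then show ?thesis
      using permutes_inj[OF \<sigma>] by (simp add: inj_def)
  qed
  show "(\<lambda>i. \<sigma> (2 * i) div 2) permutes {0..<n}"
  proof (rule inj_imp_permutes)
    show "inj_on (\<lambda>i. \<sigma> (2 * i) div 2) {0..<n}"
    proof (rule inj_onI)
      fix i j assume "i \<in> {0..<n}" "j \<in> {0..<n}" "\<sigma> (2 * i) div 2 = \<sigma> (2 * j) div 2"
      then show "i = j" using inj[of "2 * i" "2 * j"] by simp
    qed
  qed (simp_all add: lt fixed)
  show "(\<lambda>i. \<sigma> (Suc (2 * i)) div 2) permutes {0..<n}"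
  proof (rule inj_imp_permutes)
    show "inj_on (\<lambda>i. \<sigma> (Suc (2 * i)) div 2) {0..<n}"
    proof (rule inj_onI)
      fix i j assume "i \<in> {0..<n}" "j \<in> {0..<n}" "\<sigma> (Suc (2 * i)) div 2 = \<sigma> (Suc (2 * j)) div 2"
      then show "i = j" using inj[of "Suc (2 * i)" "Suc (2 * j)"] by simp
    qed
  qed (simp_all add: lt fixed)
qed

lemma bij_betw_interleave_perm:
  "bij_betw (\<lambda>(\<tau>, \<rho>). interleave_perm n \<tau> \<rho>)
     ({\<tau>. \<tau> permutes {0..<n}} \<times> {\<rho>. \<rho> permutes {0..<n}})
     {\<sigma>. \<sigma> permutes {0..<2 * n} \<and> (\<forall>c<2 * n. even (\<sigma> c) = even c)}"
proof -
  have left: "(\<lambda>i. interleave_perm n \<tau> \<rho> (2 * i) div 2) = \<tau>"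
    "(\<lambda>i. interleave_perm n \<tau> \<rho> (Suc (2 * i)) div 2) = \<rho>"
    if p: "\<tau> permutes {0..<n}" "\<rho> permutes {0..<n}" for \<tau> \<rho>
  proof -
    have "interleave_perm n \<tau> \<rho> (2 * i) div 2 = \<tau> i" for i
      using interleave_perm(3)[OF p, of i] permutes_not_in[OF interleave_perm(1)[OF p], of "2 * i"]
        permutes_not_in[OF p(1), of i] by (cases "i < n") auto
    moreover have "interleave_perm n \<tau> \<rho> (Suc (2 * i)) div 2 = \<rho> i" for i
      using interleave_perm(4)[OF p, of i] permutes_not_in[OF interleave_perm(1)[OF p], of "Suc (2 * i)"]
        permutes_not_in[OF p(2), of i] by (cases "i < n") auto
    ultimately show "(\<lambda>i. interleave_perm n \<tau> \<rho> (2 * i) div 2) = \<tau>"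
      "(\<lambda>i. interleave_perm n \<tau> \<rho> (Suc (2 * i)) div 2) = \<rho>"
      by blast+
  qed
  have right: "interleave_perm n (\<lambda>i. \<sigma> (2 * i) div 2) (\<lambda>i. \<sigma> (Suc (2 * i)) div 2) = \<sigma>"
    if \<sigma>: "\<sigma> permutes {0..<2 * n}" and par: "\<And>c. c < 2 * n \<Longrightarrow> even (\<sigma> c) = even c" for \<sigma>
  proof
    fix c
    note D = permutes_deinterleave[OF \<sigma> par]
    show "interleave_perm n (\<lambda>i. \<sigma> (2 * i) div 2) (\<lambda>i. \<sigma> (Suc (2 * i)) div 2) c = \<sigma> c"
    proof (cases "c < 2 * n")
      case True
      show ?thesis
      proof (cases "even c")
        case True
        then obtain i where i: "c = 2 * i" by blast
        then have "i < n" "even (\<sigma> (2 * i))" using \<open>c < 2 * n\<close> par by auto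
        then show ?thesis using interleave_perm(3)[OF D, of i] i by simp
      next
        case False
        then obtain i where i: "c = Suc (2 * i)" using oddE by fastforce
        then have "i < n" "odd (\<sigma> (Suc (2 * i)))" using \<open>c < 2 * n\<close> par by auto
        then show ?thesis using interleave_perm(4)[OF D, of i] i
          by (simp add: odd_two_times_div_two_succ)
      qed
    next
      case False
      then show ?thesis
        using permutes_not_in[OF \<sigma>, of c] permutes_not_in[OF interleave_perm(1)[OF D], of c] by simp
    qed
  qed
  have parity: "even (interleave_perm n \<tau> \<rho> c) = even c"
    if p: "\<tau> permutes {0..<n}" "\<rho> permutes {0..<n}" and "c < 2 * n" for \<tau> \<rho> c
  proof (cases "even c")
    case True
    then obtain i where "c = 2 * i" by blast
    then show ?thesis using that interleave_perm(3)[OF p, of i] by simp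
  next
    case False
    then obtain i where "c = Suc (2 * i)" using oddE by fastforce
    then show ?thesis using that interleave_perm(4)[OF p, of i] by simp
  qed
  show ?thesis
    by (rule bij_betw_byWitness[where
          f' = "\<lambda>\<sigma>. (\<lambda>i. \<sigma> (2 * i) div 2, \<lambda>i. \<sigma> (Suc (2 * i)) div 2)"])
      (auto simp: left right parity intro: interleave_perm(1) permutes_deinterleave)
qed

text \<open>
  The matrix is, up to the same reordering of rows and of columns, block-diagonal with blocks \<open>Z\<close>
  and \<open>Y\<close>. Sorting the factors of a product needs only that \<open>Z\<close> commutes with \<open>Y\<close>.
\<close>

lemma cdet_interleave:
  fixes Z Y :: "nat \<Rightarrow> nat \<Rightarrow> 'a::{ring,monoid_mult}"
  assumes comm: "\<And>i j k l. i < n \<Longrightarrow> j < n \<Longrightarrow> k < n \<Longrightarrow> l < n \<Longrightarrow> Z i j * Y k l = Y k l * Z i j"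
  shows "cdet (2 * n) (\<lambda>r c. if even r \<noteq> even c then 0
      else if even c then Z (r div 2) (c div 2) else Y (r div 2) (c div 2)) =
    cdet n Z * cdet n Y"
proof -
  define W where "W = (\<lambda>r c. if even r \<noteq> even c then 0
      else if even c then Z (r div 2) (c div 2) else Y (r div 2) (c div 2))"
  define sg where "sg = (\<lambda>(\<sigma> :: nat \<Rightarrow> nat) (x :: 'a). if evenperm \<sigma> then x else - x)"
  define p where "p = (\<lambda>N (M :: nat \<Rightarrow> nat \<Rightarrow> 'a) (\<sigma> :: nat \<Rightarrow> nat).
    prod_list (map (\<lambda>j. M (\<sigma> j) j) [0..<N]))"
  let ?S = "{\<sigma>. \<sigma> permutes {0..<n}}"
  have cd: "cdet N M = (\<Sum>\<sigma> | \<sigma> permutes {0..<N}. sg \<sigma> (p N M \<sigma>))" for N and M :: "nat \<Rightarrow> nat \<Rightarrow> 'a"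
    by (simp add: cdet_def sg_def p_def)
  have "cdet (2 * n) W = (\<Sum>\<sigma> | \<sigma> permutes {0..<2 * n} \<and> (\<forall>c<2 * n. even (\<sigma> c) = even c).
      sg \<sigma> (p (2 * n) W \<sigma>))"
    unfolding cd
  proof (rule sum.mono_neutral_right)
    show "\<forall>\<sigma>\<in>{\<sigma>. \<sigma> permutes {0..<2 * n}} -
        {\<sigma>. \<sigma> permutes {0..<2 * n} \<and> (\<forall>c<2 * n. even (\<sigma> c) = even c)}. sg \<sigma> (p (2 * n) W \<sigma>) = 0"
    proof clarify
      fix \<sigma> c assume c: "c < 2 * n" and nz: "sg \<sigma> (p (2 * n) W \<sigma>) \<noteq> 0"
      have "p (2 * n) W \<sigma> = 0" if "W (\<sigma> c) c = 0"
        unfolding p_def by (rule prod_list_zero_factor[OF c], fact that)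
      then have "W (\<sigma> c) c \<noteq> 0"
        using nz by (auto simp: sg_def split: if_splits)
      then show "even (\<sigma> c) = even c"
        unfolding W_def by metis
    qed
  qed (auto simp: finite_permutations)
  also have "\<dots> = (\<Sum>(\<tau>, \<rho>)\<in>?S \<times> ?S. sg (interleave_perm n \<tau> \<rho>) (p (2 * n) W (interleave_perm n \<tau> \<rho>)))"
    by (subst sum.reindex_bij_betw[OF bij_betw_interleave_perm, symmetric])
      (simp add: case_prod_unfold)
  also have "\<dots> = (\<Sum>(\<tau>, \<rho>)\<in>?S \<times> ?S. sg \<tau> (p n Z \<tau>) * sg \<rho> (p n Y \<rho>))"
  proof (rule sum.cong[OF refl], clarify)
    fix \<tau> \<rho> :: "nat \<Rightarrow> nat" assume pm: "\<tau> permutes {0..<n}" "\<rho> permutes {0..<n}"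
    have lt: "\<tau> i < n" "\<rho> i < n" if "i < n" for i
      using permutes_in_image[OF pm(1), of i] permutes_in_image[OF pm(2), of i] that by auto
    have "p (2 * n) W (interleave_perm n \<tau> \<rho>) =
        prod_list (map (\<lambda>c. if even c then Z (\<tau> (c div 2)) (c div 2)
          else Y (\<rho> (c div 2)) (c div 2)) [0..<2 * n])"
      unfolding p_def
    proof (intro arg_cong[where f = prod_list] map_cong refl)
      fix c assume "c \<in> set [0..<2 * n]"
      then have c: "c < 2 * n" by simp
      show "W (interleave_perm n \<tau> \<rho> c) c = (if even c then Z (\<tau> (c div 2)) (c div 2)
          else Y (\<rho> (c div 2)) (c div 2))"
      proof (cases "even c")
        case True
        then obtain i where "c = 2 * i" by blast
        then show ?thesis using c interleave_perm(3)[OF pm, of i] by (simp add: W_def)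
      next
        case False
        then obtain i where "c = Suc (2 * i)" using oddE by fastforce
        then show ?thesis using c interleave_perm(4)[OF pm, of i] by (simp add: W_def)
      qed
    qed
    also have "\<dots> = p n Z \<tau> * p n Y \<rho>"
      unfolding p_def by (rule prod_list_interleave) (use comm lt in auto)
    finally show "sg (interleave_perm n \<tau> \<rho>) (p (2 * n) W (interleave_perm n \<tau> \<rho>)) =
        sg \<tau> (p n Z \<tau>) * sg \<rho> (p n Y \<rho>)"
      using interleave_perm(2)[OF pm] by (simp add: sg_def)
  qed
  also have "\<dots> = cdet n Z * cdet n Y"
    unfolding cd by (simp add: sum_product sum.cartesian_product)
  finally show ?thesis unfolding W_def .
qed

section \<open>Pairs of columns\<close>

lemma cdet_eq_0:
  fixes M :: "nat \<Rightarrow> nat \<Rightarrow> 'a::{ring,monoid_mult}"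
  assumes "\<And>\<sigma>. \<sigma> permutes {0..<N} \<Longrightarrow> \<exists>c<N. M (\<sigma> c) c = 0"
  shows "cdet N M = 0"
proof -
  have "prod_list (map (\<lambda>c. M (\<sigma> c) c) [0..<N]) = 0" if \<sigma>: "\<sigma> permutes {0..<N}" for \<sigma>
  proof -
    obtain c where "c < N" "M (\<sigma> c) c = 0" using assms[OF \<sigma>] by blast
    then show ?thesis by (rule prod_list_zero_factor)
  qed
  then show ?thesis
    unfolding cdet_def by (intro sum.neutral) simp
qed

text \<open>
  Column \<open>m\<close> of \<open>f\<close> placed on the even rows, respectively on the odd rows; the other rows are 0.
\<close>

definition even_rows :: "(nat \<Rightarrow> nat \<Rightarrow> 'a::zero) \<Rightarrow> nat \<Rightarrow> nat \<Rightarrow> 'a" where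
  "even_rows f r m = (if even r then f (r div 2) m else 0)"

definition odd_rows :: "(nat \<Rightarrow> nat \<Rightarrow> 'a::zero) \<Rightarrow> nat \<Rightarrow> nat \<Rightarrow> 'a" where
  "odd_rows f r m = (if odd r then f (r div 2) m else 0)"

text \<open>
  The columns \<open>2m\<close> and \<open>2m+1\<close> are replaced, one pair after the other, by \<open>Z, Y\<close> with the factor
  \<open>2u\<close>; the error term with the columns \<open>Y, Y\<close> does not contribute.
\<close>

lemma cdet_column_pairs:
  fixes X X' Y Z :: "nat \<Rightarrow> nat \<Rightarrow> 'a::{ring,monoid_mult}" and u :: 'a
  assumes u: "\<And>x. u * x = x * u"
    and XX': "\<And>i j m. i < n \<Longrightarrow> j < n \<Longrightarrow> m < n \<Longrightarrow> X i m * X' j m = X j m * X' i m"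
    and XY: "\<And>i j m. i < n \<Longrightarrow> j < n \<Longrightarrow> m < n \<Longrightarrow> X i m * Y j m = Y j m * X i m"
    and X'Y: "\<And>i j m. i < n \<Longrightarrow> j < n \<Longrightarrow> m < n \<Longrightarrow> X' i m * Y j m = Y j m * X' i m"
    and ZY: "\<And>i j m l. i < n \<Longrightarrow> j < n \<Longrightarrow> m < n \<Longrightarrow> l < n \<Longrightarrow> Z i m * Y j l = Y j l * Z i m"
    and Z: "\<And>i m. i < n \<Longrightarrow> m < n \<Longrightarrow> X i m + X' i m = Z i m + Z i m"
  shows "cdet (2 * n) (\<lambda>r c. if even c then even_rows X r (c div 2) + odd_rows Y r (c div 2)
      else u * odd_rows Y r (c div 2) - u * even_rows X' r (c div 2)) =
    (u + u) ^ n * (cdet n Z * cdet n Y)"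
proof -
  \<comment> \<open>\<open>w m\<close> tells what stands in the pair \<open>m\<close>: the original columns (0), \<open>Z, Y\<close> (1), or \<open>Y, Y\<close> (2).\<close>
  define W :: "(nat \<Rightarrow> nat) \<Rightarrow> nat \<Rightarrow> nat \<Rightarrow> 'a" where "W = (\<lambda>w r c.
    if w (c div 2) = 0 then
      (if even c then even_rows X r (c div 2) + odd_rows Y r (c div 2)
       else u * odd_rows Y r (c div 2) - u * even_rows X' r (c div 2))
    else if w (c div 2) = 1 \<and> even c then even_rows Z r (c div 2)
    else odd_rows Y r (c div 2))"
  have step: "cdet (2 * n) (W w) =
      (u + u) * cdet (2 * n) (W (w(m := 1))) + u * cdet (2 * n) (W (w(m := 2)))"
    if w: "w m = 0" and m: "m < n" for w m
  proof (rule cdet_adjacent_columns[where j = "2 * m"])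
    show "Suc (2 * m) < 2 * n" using m by simp
    show "central (u + u)" "central u"
      using u by (simp_all add: central_def distrib_left distrib_right)
    have other: "c div 2 \<noteq> m" if "c \<noteq> 2 * m" "c \<noteq> Suc (2 * m)" for c
      using that by presburger
    show "W (w(m := 1)) r c = W w r c" "W (w(m := 2)) r c = W w r c"
      if "c \<noteq> 2 * m" "c \<noteq> Suc (2 * m)" for r c
      using other[OF that] by (simp_all add: W_def)
    fix r s assume rs: "r < 2 * n" "s < 2 * n"
    define x x' y z where "x = (\<lambda>r. even_rows X r m)" and "x' = (\<lambda>r. even_rows X' r m)"
      and "y = (\<lambda>r. odd_rows Y r m)" and "z = (\<lambda>r. even_rows Z r m)"
    have 1: "x r * x' s = x s * x' r"
      using XX'[of "r div 2" "s div 2" m] rs m by (simp add: x_def x'_def even_rows_def)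
    have 2: "x t * y t' = y t' * x t" "x' t * y t' = y t' * x' t" "x t + x' t = z t + z t"
      if "t < 2 * n" "t' < 2 * n" for t t'
      using XY[of "t div 2" "t' div 2" m] X'Y[of "t div 2" "t' div 2" m] Z[of "t div 2" m] that m
      by (simp_all add: x_def x'_def y_def z_def even_rows_def odd_rows_def)
    have "(x r + y r) * (y s - x' s) - (x s + y s) * (y r - x' r) =
        (x r + x' r) * y s - (x s + x' s) * y r + (y r * y s - y s * y r)"
      using 1 2(1,2)[of r s] 2(1,2)[of s r] rs by (simp add: algebra_simps)
    also have "\<dots> = (z r * y s - z s * y r) + (z r * y s - z s * y r) + (y r * y s - y s * y r)"
      using 2(3)[of r r] 2(3)[of s s] rs by (simp add: algebra_simps)
    finally have "u * ((x r + y r) * (y s - x' s) - (x s + y s) * (y r - x' r)) =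
        (u + u) * (z r * y s - z s * y r) + u * (y r * y s - y s * y r)"
      by (simp add: distrib_left distrib_right)
    moreover have "v * (u * b - u * a) = u * (v * (b - a))" for v a b
      by (metis mult.assoc right_diff_distrib u)
    ultimately have "(x r + y r) * (u * y s - u * x' s) - (x s + y s) * (u * y r - u * x' r) =
        (u + u) * (z r * y s - z s * y r) + u * (y r * y s - y s * y r)"
      by (simp add: right_diff_distrib)
    then show "W w r (2 * m) * W w s (Suc (2 * m)) - W w s (2 * m) * W w r (Suc (2 * m)) =
      (u + u) * (W (w(m := 1)) r (2 * m) * W (w(m := 1)) s (Suc (2 * m)) -
        W (w(m := 1)) s (2 * m) * W (w(m := 1)) r (Suc (2 * m))) +
      u * (W (w(m := 2)) r (2 * m) * W (w(m := 2)) s (Suc (2 * m)) -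
        W (w(m := 2)) s (2 * m) * W (w(m := 2)) r (Suc (2 * m)))"
      using w by (simp add: W_def x_def x'_def y_def z_def)
  qed
  \<comment> \<open>Induction on the number of original pairs, which \<open>step\<close> removes.\<close>
  have zero: "cdet (2 * n) (W w) = 0" if "m < n" "w m = 2" for w m
    using that
  proof (induction "card {k\<in>{0..<n}. w k = 0}" arbitrary: w)
    case 0
    then have nz: "w k \<noteq> 0" if "k < n" for k
      using that by auto
    \<comment> \<open>All \<open>n\<close> columns with odd index and the column \<open>2m\<close> are supported on the \<open>n\<close> odd rows.\<close>
    let ?Y = "insert (2 * m) ((\<lambda>i. Suc (2 * i)) ` {0..<n})"
    let ?O = "(\<lambda>i. Suc (2 * i)) ` {0..<n}"
    have card_O: "card ?O = n"
      by (subst card_image) (auto simp: inj_on_def)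
    have "2 * m \<notin> ?O" by (auto, presburger)
    then have card_Y: "card ?Y = Suc n"
      using card_O by simp
    show ?case
    proof (rule cdet_eq_0, rule ccontr)
      fix \<sigma> assume \<sigma>: "\<sigma> permutes {0..<2 * n}" and "\<not> (\<exists>c<2 * n. W w (\<sigma> c) c = 0)"
      then have W: "W w (\<sigma> c) c \<noteq> 0" if "c < 2 * n" for c
        using that by blast
      have "\<sigma> c \<in> ?O" if "c \<in> ?Y" for c
      proof -
        have c: "c < 2 * n" using that \<open>m < n\<close> by auto
        have "W w (\<sigma> c) c = odd_rows Y (\<sigma> c) (c div 2)"
          using that \<open>w m = 2\<close> nz[of "c div 2"] c by (auto simp: W_def)
        with W[OF c] have "odd (\<sigma> c)"
          by (auto simp: odd_rows_def split: if_splits)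
        moreover have "\<sigma> c < 2 * n"
          using permutes_in_image[OF \<sigma>, of c] c by simp
        ultimately show ?thesis
          by (auto elim!: oddE)
      qed
      then have "\<sigma> ` ?Y \<subseteq> ?O" by blast
      then have "card (\<sigma> ` ?Y) \<le> card ?O"
        by (intro card_mono) auto
      moreover have "card (\<sigma> ` ?Y) = card ?Y"
        by (intro card_image inj_on_subset[OF permutes_inj[OF \<sigma>]]) auto
      ultimately show False
        using card_O card_Y by simp
    qed
  next
    case (Suc N)
    have "card {k\<in>{0..<n}. w k = 0} \<noteq> 0" using Suc.hyps(2) by linarith
    then have "{k\<in>{0..<n}. w k = 0} \<noteq> {}" by (metis card.empty)
    then obtain k where k: "k < n" "w k = 0" by auto
    have zero_step: "cdet (2 * n) (W (w(k := v))) = 0" if "v \<noteq> 0" for v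
    proof (rule Suc.hyps(1))
      have "{i\<in>{0..<n}. (w(k := v)) i = 0} = {i\<in>{0..<n}. w i = 0} - {k}"
        using that by auto
      then show "N = card {i\<in>{0..<n}. (w(k := v)) i = 0}"
        using Suc.hyps(2) k by simp
      show "(w(k := v)) m = 2" using Suc.prems k by auto
    qed fact
    show ?case
      unfolding step[of w k, OF k(2,1)] by (simp add: zero_step)
  qed
  have "cdet (2 * n) (W (\<lambda>_. 0)) = (u + u) ^ k * cdet (2 * n) (W (\<lambda>m. if m < k then 1 else 0))"
    if "k \<le> n" for k
    using that
  proof (induction k)
    case 0
    then show ?case by simp
  next
    case (Suc k)
    let ?w = "\<lambda>m. if m < k then 1 else 0 :: nat"
    have w': "?w(k := 1) = (\<lambda>m. if m < Suc k then 1 else 0)"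
      by (auto simp: less_Suc_eq)
    have "cdet (2 * n) (W ?w) = (u + u) * cdet (2 * n) (W (\<lambda>m. if m < Suc k then 1 else 0))"
      using step[of ?w k] zero[of k "?w(k := 2)"] Suc.prems unfolding w' by simp
    then show ?case
      using Suc by (simp add: power_Suc2 mult.assoc del: power_Suc)
  qed
  from this[of n] have "cdet (2 * n) (W (\<lambda>_. 0)) =
      (u + u) ^ n * cdet (2 * n) (W (\<lambda>m. if m < n then 1 else 0))"
    by simp
  moreover have "cdet (2 * n) (W (\<lambda>m. if m < n then 1 else 0)) =
      cdet (2 * n) (\<lambda>r c. if even r \<noteq> even c then 0
      else if even c then Z (r div 2) (c div 2) else Y (r div 2) (c div 2))"
    by (rule cdet_cong) (auto simp: W_def even_rows_def odd_rows_def)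
  moreover have "\<dots> = cdet n Z * cdet n Y"
    by (rule cdet_interleave) (use ZY in auto)
  ultimately show ?thesis
    by (simp add: W_def)
qed

section \<open>The factorization\<close>

text \<open>
  The three relations, for two entries \<open>c1, c2\<close> of a column of \<open>C\<close> and the entries \<open>p1, p2\<close> of \<open>Q\<close>
  in the same places, make the product of two columns shifted by \<open>1\<close> against each other symmetric.
  The coefficients of \<open>t\<^sup>0\<close>, \<open>t\<^sup>1\<close> and \<open>t\<^sup>2\<close> are compared separately.
\<close>

lemma shifted_columns_symmetric:
  fixes c1 c2 p1 p2 t :: "'a::{ring,monoid_mult}"
  assumes cc: "commutator c1 c2 = c1 * p2 - c2 * p1"
    and cp: "commutator c1 p2 = commutator c2 p1"
    and pp: "commutator p1 p2 = 0"
    and t: "\<And>x. t * x = x * t"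
  shows "(c1 + p1 * (t + 1)) * (c2 + p2 * t) = (c2 + p2 * (t + 1)) * (c1 + p1 * t)"
proof -
  have "(c1 + p1 * (t + 1)) * (c2 + p2 * t) =
      c1 * c2 + p1 * c2 + (c1 * p2 + p1 * c2 + p1 * p2) * t + p1 * p2 * t * t"
    for c1 c2 p1 p2
    using t[of c2] t[of p2] by (simp add: algebra_simps) (metis mult.assoc t)
  moreover have swap: "c1 * p2 + p1 * c2 = c2 * p1 + p2 * c1"
    using cp by (simp add: commutator_def algebra_simps)
  moreover have "c1 * c2 + p1 * c2 = c2 * c1 + p2 * c1"
  proof -
    have "c1 * c2 + p1 * c2 = c2 * c1 + (c1 * p2 + p1 * c2) - c2 * p1"
      using cc by (simp add: commutator_def algebra_simps)
    then show ?thesis unfolding swap by simp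
  qed
  moreover have "p1 * p2 = p2 * p1"
    using pp by (simp add: commutator_def)
  ultimately show ?thesis by simp
qed

lemma commute_linear_combination:
  fixes c p c' p' s t :: "'a::ring"
  assumes "c * c' = c' * c" "c * p' = p' * c" "p * c' = c' * p" "p * p' = p' * p"
    and s: "\<And>x. s * x = x * s" and t: "\<And>x. t * x = x * t"
  shows "(c + p * s) * (c' + p' * t) = (c' + p' * t) * (c + p * s)"
proof -
  have "p * s * c' = c' * (p * s)"
    by (metis assms(3) mult.assoc s)
  moreover have "c * (p' * t) = p' * t * c"
    by (metis assms(2) mult.assoc t)
  moreover have "p * s * (p' * t) = p' * t * (p * s)"
    by (metis assms(4) mult.assoc s t)
  ultimately show ?thesis
    using assms(1) by (simp add: distrib_left distrib_right)
qed

text \<open>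
  The entry of \<open>C\<^sup>\<real> + Q\<^sup>\<real> T\<close> in row \<open>r\<close> and column \<open>c\<close>, where \<open>A, B\<close> are the real and imaginary
  parts of \<open>C\<close> and \<open>E, F\<close> those of \<open>Q\<close>, the block \<open>m\<close> of \<open>T\<close> is \<open>(D m + q, u q; u q, D m - q)\<close>, and
  \<open>q\<close> stands for \<open>1/4\<close>.
\<close>

definition doubled_entry ::
  "'a::ring \<Rightarrow> 'a \<Rightarrow> (nat \<Rightarrow> nat \<Rightarrow> 'a) \<Rightarrow> (nat \<Rightarrow> nat \<Rightarrow> 'a) \<Rightarrow> (nat \<Rightarrow> nat \<Rightarrow> 'a) \<Rightarrow>
    (nat \<Rightarrow> nat \<Rightarrow> 'a) \<Rightarrow> (nat \<Rightarrow> 'a) \<Rightarrow> nat \<Rightarrow> nat \<Rightarrow> 'a" where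
  "doubled_entry u q A B E F D r c = (let i = r div 2; m = c div 2 in
      if even r then
        if even c then A i m + (E i m * (D m + q) + F i m * (u * q))
        else B i m + (E i m * (u * q) + F i m * (D m - q))
      else
        if even c then - B i m + (- F i m * (D m + q) + E i m * (u * q))
        else A i m + (- F i m * (u * q) + E i m * (D m - q)))"

text \<open>
  The factorization in any ring with central elements \<open>u\<close> and \<open>q\<close> such that \<open>u\<^sup>2 = -1\<close> and
  \<open>4q = 1\<close>. Here \<open>P\<close> plays the role of \<open>Q\<close>, and \<open>C', P'\<close> are the conjugates with respect to \<open>u\<close>;
  only \<open>C\<close> and \<open>P\<close> are subject to the three relations.
\<close>

lemma cdet_doubled_factorization:
  fixes A B E F C P C' P' :: "nat \<Rightarrow> nat \<Rightarrow> 'a::{ring,monoid_mult}" and u q :: 'a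
    and D :: "nat \<Rightarrow> 'a"
  assumes u: "\<And>x. u * x = x * u" and uu: "u * u = - 1"
    and q: "\<And>x. q * x = x * q" and q4: "q + q + (q + q) = 1"
    and D: "\<And>m x. m < n \<Longrightarrow> D m * x = x * D m"
    and CP: "\<And>i j. C i j = A i j + u * B i j" "\<And>i j. P i j = E i j + u * F i j"
    and CP': "\<And>i j. C' i j = A i j - u * B i j" "\<And>i j. P' i j = E i j - u * F i j"
    and comm: "\<And>i j k l S S'. i < n \<Longrightarrow> j < n \<Longrightarrow> k < n \<Longrightarrow> l < n \<Longrightarrow> S \<in> {C, P} \<Longrightarrow> S' \<in> {C', P'} \<Longrightarrow>
      S i j * S' k l = S' k l * S i j"
    and cc: "\<And>i j k. i < n \<Longrightarrow> j < n \<Longrightarrow> k < n \<Longrightarrow>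
      commutator (C i k) (C j k) = C i k * P j k - C j k * P i k"
    and cp: "\<And>i j k. i < n \<Longrightarrow> j < n \<Longrightarrow> k < n \<Longrightarrow>
      commutator (C i k) (P j k) = commutator (C j k) (P i k)"
    and pp: "\<And>i j k. i < n \<Longrightarrow> j < n \<Longrightarrow> k < n \<Longrightarrow> commutator (P i k) (P j k) = 0"
  shows "cdet (2 * n) (doubled_entry u q A B E F D) =
    cdet n (\<lambda>i m. C i m + P i m * D m) * cdet n (\<lambda>i m. C' i m + P' i m * D m)"
    (is "cdet (2 * n) ?M = _")
proof -
  \<comment> \<open>\<open>h\<close> stands for \<open>1/2\<close>; thus \<open>D m + h = (D m - h) + 1\<close>.\<close>
  define h where "h = q + q"
  have h: "h * x = x * h" for x by (simp add: h_def distrib_left distrib_right q)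
  have h2: "h + h = 1" using q4 by (simp add: h_def)
  define X X' where "X = (\<lambda>i m. C i m + P i m * (D m - h + 1))"
    and "X' = (\<lambda>i m. C i m + P i m * (D m - h))"
  define Z Y where "Z = (\<lambda>i m. C i m + P i m * D m)" and "Y = (\<lambda>i m. C' i m + P' i m * D m)"
  have Dh: "(D m - h) * x = x * (D m - h)" "(D m - h + 1) * x = x * (D m - h + 1)"
    if "m < n" for m x
    using D[OF that] h by (simp_all add: algebra_simps)
  have s1: "D m - h + 1 = D m + h" for m
    using h2 by (simp add: algebra_simps)
  have X: "X i m = C i m + P i m * (D m + h)" for i m
    by (simp add: X_def s1)
  have u2: "u * (u * x) = - x" for x
    using uu by (simp add: mult.assoc[symmetric])
  have rows: "cdet (2 * n) (\<lambda>r j. if even r then ?M r j - u * ?M (Suc r) j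
      else ?M (r - 1) j + u * ?M r j) = (u + u) ^ n * cdet (2 * n) ?M"
    by (rule cdet_row_pairs[OF u])
  have entries: "(if even r then ?M r c - u * ?M (Suc r) c else ?M (r - 1) c + u * ?M r c) =
    (if even c then even_rows X r (c div 2) + odd_rows Y r (c div 2)
      else u * odd_rows Y r (c div 2) - u * even_rows X' r (c div 2))" for r c
  proof -
    let ?i = "r div 2" and ?m = "c div 2"
    have u3: "E ?i ?m * u = u * E ?i ?m" "E ?i ?m * (u * x) = u * (E ?i ?m * x)"
      "F ?i ?m * u = u * F ?i ?m" "F ?i ?m * (u * x) = u * (F ?i ?m * x)" for x
      by (metis u mult.assoc)+
    show ?thesis
    proof (cases "even r")
      case True
      then show ?thesis
        by (simp add: doubled_entry_def Let_def even_rows_def odd_rows_def X X'_def CP h_def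
            algebra_simps u2 u3)
    next
      case False
      then have "(r - 1) div 2 = r div 2" "even (r - 1)" by (auto elim: oddE)
      with False show ?thesis
        by (simp add: doubled_entry_def Let_def even_rows_def odd_rows_def Y_def CP' h_def
            distrib_left distrib_right left_diff_distrib right_diff_distrib mult.assoc u2 u3)
    qed
  qed
  have "(u + u) ^ n * cdet (2 * n) ?M = (u + u) ^ n * (cdet n Z * cdet n Y)"
    unfolding rows[symmetric] entries
  proof (rule cdet_column_pairs[OF u])
    fix i j m l assume lt: "i < n" "j < n" "m < n"
    show "X i m * X' j m = X j m * X' i m"
      unfolding X_def X'_def
      by (rule shifted_columns_symmetric) (use lt cc cp pp Dh in auto)
    have "C i m * C' j l = C' j l * C i m" "C i m * P' j l = P' j l * C i m"
      "P i m * C' j l = C' j l * P i m" "P i m * P' j l = P' j l * P i m" if "l < n" for l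
      by (rule comm[OF lt(1,3,2) that]; simp)+
    note * = commute_linear_combination[OF this(1-4)]
    show "X i m * Y j m = Y j m * X i m" "X' i m * Y j m = Y j m * X' i m"
      unfolding X_def X'_def Y_def by (intro * lt Dh D)+
    show "Z i m * Y j l = Y j l * Z i m" if "l < n"
      unfolding Z_def Y_def by (intro * lt that D)
    show "X i m + X' i m = Z i m + Z i m"
      unfolding X_def X'_def Z_def s1 by (simp add: distrib_left right_diff_distrib)
  qed
  moreover have "x = y" if "(u + u) ^ n * x = (u + u) ^ n * y" for x y
  proof -
    \<comment> \<open>As \<open>u\<^sup>2 = -1\<close> and \<open>2h = 1\<close>, the element \<open>-uh\<close> is an inverse of \<open>2u\<close>.\<close>
    have inverse: "- (u * h) * ((u + u) * z) = z" for z
    proof -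
      have "- (u * h) * ((u + u) * z) = - (u * (h * (u * (z + z))))"
        by (simp add: distrib_left distrib_right mult.assoc)
      also have "h * (u * (z + z)) = u * (h * (z + z))"
        by (metis mult.assoc u)
      also have "- (u * (u * (h * (z + z)))) = (h + h) * z"
        by (simp add: u2 distrib_left distrib_right)
      finally show ?thesis by (simp add: h2)
    qed
    show ?thesis
      using that
    proof (induction n arbitrary: x y)
      case (Suc k)
      then have "(u + u) * ((u + u) ^ k * x) = (u + u) * ((u + u) ^ k * y)"
        by (simp add: mult.assoc)
      then have "(u + u) ^ k * x = (u + u) ^ k * y"
        by (metis inverse)
      then show ?case by (rule Suc.IH)
    qed simp
  qed
  ultimately show ?thesis
    unfolding Z_def Y_def by blast
qed

section \<open>Real and imaginary parts, and the matrix of shifts\<close>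

lemma
  fixes x y :: "'a::ring cplx"
  shows bar_diff: "bar (x - y) = bar x - bar y"
    and bar_mult: "bar (x * y) = bar x * bar y"
    and bar_zero: "bar (0 :: 'a cplx) = 0"
  by (simp_all add: bar_def plus_cplx_def minus_cplx_def times_cplx_def zero_cplx_def algebra_simps)

lemma bar_commutator: "bar (commutator x y) = commutator (bar x) (bar y)" for x y :: "'a::ring cplx"
  by (simp add: commutator_def bar_diff bar_mult)

lemma bar_eq_re_im:
  "bar c = of_base (re c) - imag_unit * of_base (im c)" for c :: "'a::{ring,monoid_mult} cplx"
  by (simp add: bar_def of_base_def imag_unit_def minus_cplx_def times_cplx_def)

lemma of_base_uminus: "of_base (- a) = - of_base a" for a :: "'a::ring"
  by (simp add: of_base_def uminus_cplx_def)

lemma scalar_central: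
  assumes "unital_algebra scale"
  shows "of_base (scale c 1) * x = x * of_base (scale c 1)"
proof -
  interpret unital_algebra scale by fact
  have "scale c 1 * y = y * scale c 1" for y
    by (simp add: scale_mult_left scale_mult_right)
  then show ?thesis
    by (simp add: of_base_def times_cplx_def)
qed

text \<open>
  Characteristic different from 2 is needed for \<open>1 / 4\<close>, which would be 0 otherwise.
\<close>

lemma four_quarters:
  fixes scale :: "'k::field \<Rightarrow> 'a::{ring,monoid_mult} \<Rightarrow> 'a"
  assumes "unital_algebra scale" "CHAR('k) \<noteq> 2"
  shows "of_base (scale (1 / 4) 1) + of_base (scale (1 / 4) 1) +
    (of_base (scale (1 / 4) 1) + of_base (scale (1 / 4) 1)) = 1"
proof -
  interpret unital_algebra scale by fact
  have "(2 :: 'k) \<noteq> 0"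
  proof
    assume "(2 :: 'k) = 0"
    then have "of_nat 2 = (0 :: 'k)" by simp
    then have "CHAR('k) dvd 2" by (simp only: of_nat_eq_0_iff_char_dvd)
    then have "CHAR('k) \<le> 2" "CHAR('k) \<noteq> 0"
      using dvd_imp_le[of "CHAR('k)" 2] by (auto intro: Nat.gr0I)
    moreover have "CHAR('k) \<noteq> Suc 0" by (rule CHAR_not_1)
    ultimately show False using assms(2) by linarith
  qed
  then have "(2 :: 'k) * 2 \<noteq> 0" by (simp only: mult_eq_0_iff) blast
  then have "(4 :: 'k) \<noteq> 0" by simp
  then have "(1 / 4 + 1 / 4 + (1 / 4 + 1 / 4) :: 'k) = 1"
    unfolding add_divide_distrib[symmetric] by simp
  then have "scale (1 / 4) 1 + scale (1 / 4) 1 + (scale (1 / 4) 1 + scale (1 / 4) 1) = 1"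
    by (metis scale_left_distrib scale_one)
  then show ?thesis
    by (simp only: of_base_add[symmetric] of_base_one)
qed

lemma realify_carrier:
  assumes "M \<in> carrier_mat n m"
  shows "realify M \<in> carrier_mat (2 * n) (2 * m)"
  using assms by (simp add: realify_def mat_of_blocks2_def)

lemma realify_index:
  assumes "M \<in> carrier_mat n m" "i < n" "j < m"
  shows "realify M $$ (2 * i, 2 * j) = re (M $$ (i, j))"
    and "realify M $$ (2 * i, Suc (2 * j)) = im (M $$ (i, j))"
    and "realify M $$ (Suc (2 * i), 2 * j) = - im (M $$ (i, j))"
    and "realify M $$ (Suc (2 * i), Suc (2 * j)) = re (M $$ (i, j))"
  using assms by (simp_all add: realify_def mat_of_blocks2_def mat_of_rows_list_def)

lemma shift_mat_carrier: "shift_mat scale u n d \<in> carrier_mat (2 * n) (2 * n)"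
  by (simp add: shift_mat_def mat_of_blocks2_def Let_def)

lemma shift_mat_index:
  assumes "m < n"
  shows "shift_mat scale u n d $$ (2 * m, 2 * m) = d (n - m) + of_base (scale (1 / 4) 1)"
    and "shift_mat scale u n d $$ (2 * m, Suc (2 * m)) = u * of_base (scale (1 / 4) 1)"
    and "shift_mat scale u n d $$ (Suc (2 * m), 2 * m) = u * of_base (scale (1 / 4) 1)"
    and "shift_mat scale u n d $$ (Suc (2 * m), Suc (2 * m)) = d (n - m) - of_base (scale (1 / 4) 1)"
  using assms by (simp_all add: shift_mat_def mat_of_blocks2_def mat_of_rows_list_def Let_def)

lemma shift_mat_index_off_block:
  assumes "k < 2 * n" "c < 2 * n" "k div 2 \<noteq> c div 2"
  shows "shift_mat scale u n d $$ (k, c) = 0"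
  using assms by (simp add: shift_mat_def mat_of_blocks2_def Let_def)

lemma times_shift_mat_index:
  assumes M: "M \<in> carrier_mat r (2 * n)" and i: "i < r" and c: "c < 2 * n"
  shows "(M * shift_mat scale u n d) $$ (i, c) =
    M $$ (i, 2 * (c div 2)) * shift_mat scale u n d $$ (2 * (c div 2), c) +
    M $$ (i, Suc (2 * (c div 2))) * shift_mat scale u n d $$ (Suc (2 * (c div 2)), c)"
proof -
  let ?T = "shift_mat scale u n d"
  have T: "?T \<in> carrier_mat (2 * n) (2 * n)" by (rule shift_mat_carrier)
  have "(M * ?T) $$ (i, c) = (\<Sum>k\<in>{0..<2 * n}. M $$ (i, k) * ?T $$ (k, c))"
    using M T i c by (simp add: scalar_prod_def)
  also have "\<dots> = (\<Sum>k\<in>{2 * (c div 2), Suc (2 * (c div 2))}. M $$ (i, k) * ?T $$ (k, c))"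
  proof (rule sum.mono_neutral_right)
    show "{2 * (c div 2), Suc (2 * (c div 2))} \<subseteq> {0..<2 * n}"
      using less_mult_imp_div_less[of c n 2] c by (auto simp: mult.commute)
    show "\<forall>k\<in>{0..<2 * n} - {2 * (c div 2), Suc (2 * (c div 2))}. M $$ (i, k) * ?T $$ (k, c) = 0"
    proof
      fix k assume k: "k \<in> {0..<2 * n} - {2 * (c div 2), Suc (2 * (c div 2))}"
      then have "k div 2 \<noteq> c div 2" by auto
      with k c show "M $$ (i, k) * ?T $$ (k, c) = 0"
        by (simp add: shift_mat_index_off_block)
    qed
  qed simp
  finally show ?thesis by simp
qed

lemma realify_plus_shift_index:
  fixes C Q :: "'a::{ring,monoid_mult} cplx mat" and scale :: "'k::field \<Rightarrow> 'a \<Rightarrow> 'a"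
  assumes C: "C \<in> carrier_mat n n" and Q: "Q \<in> carrier_mat n n" and rc: "r < 2 * n" "c < 2 * n"
  defines "A \<equiv> \<lambda>i j. of_base (re (C $$ (i, j)))" and "B \<equiv> \<lambda>i j. of_base (im (C $$ (i, j)))"
    and "E \<equiv> \<lambda>i j. of_base (re (Q $$ (i, j)))" and "F \<equiv> \<lambda>i j. of_base (im (Q $$ (i, j)))"
    and "q \<equiv> of_base (scale (1 / 4) 1)"
  shows "(map_mat of_base (realify C) + map_mat of_base (realify Q) * shift_mat scale u n d) $$ (r, c) =
    doubled_entry u q A B E F (\<lambda>m. d (n - m)) r c"
proof -
  have RC: "realify C \<in> carrier_mat (2 * n) (2 * n)" and RQ: "realify Q \<in> carrier_mat (2 * n) (2 * n)"
    using C Q realify_carrier by blast+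
  obtain i where i: "r = 2 * i \<or> r = Suc (2 * i)" by (metis oddE evenE Suc_eq_plus1)
  obtain m where m: "c = 2 * m \<or> c = Suc (2 * m)" by (metis oddE evenE Suc_eq_plus1)
  have lt: "i < n" "m < n" using i m rc by auto
  have d2: "r div 2 = i" "c div 2 = m" using i m by auto
  have "(map_mat of_base (realify C) + map_mat of_base (realify Q) * shift_mat scale u n d) $$ (r, c) =
      of_base (realify C $$ (r, c)) +
      (of_base (realify Q $$ (r, 2 * m)) * shift_mat scale u n d $$ (2 * m, c) +
       of_base (realify Q $$ (r, Suc (2 * m))) * shift_mat scale u n d $$ (Suc (2 * m), c))"
    using RC RQ rc lt d2 shift_mat_carrier[of scale u n d]
      times_shift_mat_index[of "map_mat of_base (realify Q)" "2 * n" n r c scale u d]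
    by simp
  also have "\<dots> = (if even r then
        if even c then A i m + (E i m * (d (n - m) + q) + F i m * (u * q))
        else B i m + (E i m * (u * q) + F i m * (d (n - m) - q))
      else
        if even c then - B i m + (- F i m * (d (n - m) + q) + E i m * (u * q))
        else A i m + (- F i m * (u * q) + E i m * (d (n - m) - q)))"
    using i m by (auto simp: realify_index[OF C lt] realify_index[OF Q lt] shift_mat_index[OF lt(2)]
        of_base_uminus A_def B_def E_def F_def q_def)
  finally show ?thesis
    by (simp add: doubled_entry_def d2 Let_def)
qed

lemma col_det_plus_diag:
  fixes C Q :: "'a::{ring,monoid_mult} mat"
  assumes "C \<in> carrier_mat n n" "Q \<in> carrier_mat n n"
  shows "col_det (C + Q * mat_diag n f) = cdet n (\<lambda>i m. C $$ (i, m) + Q $$ (i, m) * f m)"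
proof -
  have "Q * mat_diag n f \<in> carrier_mat n n"
    using assms(2) by simp
  then have "C + Q * mat_diag n f \<in> carrier_mat n n"
    by simp
  then show ?thesis
    unfolding col_det_eq_cdet using assms
    by (auto intro!: cdet_cong simp: mat_diag_mult_right)
qed

theorem theorem2:
  fixes scale :: "'k::field \<Rightarrow> 'a::{ring,monoid_mult} \<Rightarrow> 'a"
    and C Q :: "'a cplx mat"
    and d :: "nat \<Rightarrow> 'a cplx"
    and n :: nat
  assumes "CHAR('k) \<noteq> 2"
    and "unital_algebra scale"
    and "C \<in> carrier_mat n n" and "Q \<in> carrier_mat n n"
    and "\<And>\<alpha> \<beta>. \<alpha> \<in> elements_mat C \<union> elements_mat Q \<Longrightarrow> \<beta> \<in> elements_mat C \<union> elements_mat Q \<Longrightarrow>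
           commutator \<alpha> (bar \<beta>) = 0"
    and "\<And>i j k. i < n \<Longrightarrow> j < n \<Longrightarrow> k < n \<Longrightarrow>
           commutator (C $$ (i, k)) (C $$ (j, k)) =
             C $$ (i, k) * Q $$ (j, k) - C $$ (j, k) * Q $$ (i, k)"
    and "\<And>i j k. i < n \<Longrightarrow> j < n \<Longrightarrow> k < n \<Longrightarrow>
           commutator (C $$ (i, k)) (Q $$ (j, k)) = commutator (C $$ (j, k)) (Q $$ (i, k))"
    and "\<And>i j k. i < n \<Longrightarrow> j < n \<Longrightarrow> k < n \<Longrightarrow> commutator (Q $$ (i, k)) (Q $$ (j, k)) = 0"
    and "\<And>j. j \<in> {1..n} \<Longrightarrow> central (d j)"
  shows "col_det (map_mat of_base (realify C) +
             map_mat of_base (realify Q) * shift_mat scale imag_unit n d) =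
           col_det (C + Q * mat_diag n (\<lambda>m. d (n - m))) *
           col_det (map_mat bar C + map_mat bar Q * mat_diag n (\<lambda>m. d (n - m))) \<and>
         col_det (map_mat of_base (realify C) +
             map_mat of_base (realify Q) * shift_mat scale (- imag_unit) n d) =
           col_det (C + Q * mat_diag n (\<lambda>m. d (n - m))) *
           col_det (map_mat bar C + map_mat bar Q * mat_diag n (\<lambda>m. d (n - m)))"
proof -
  note C = assms(3) and Q = assms(4) and cc = assms(6) and cp = assms(7) and pp = assms(8)
  define c p cb pb where "c = (\<lambda>i j. C $$ (i, j))" and "p = (\<lambda>i j. Q $$ (i, j))"
    and "cb = (\<lambda>i j. bar (C $$ (i, j)))" and "pb = (\<lambda>i j. bar (Q $$ (i, j)))"
  define D where "D = (\<lambda>m. d (n - m))"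
  let ?Z = "cdet n (\<lambda>i m. c i m + p i m * D m)" and ?Y = "cdet n (\<lambda>i m. cb i m + pb i m * D m)"
  let ?q = "of_base (scale (1 / 4) 1)"
  have D: "D m * x = x * D m" if "m < n" for m x
    using assms(9)[of "n - m"] that by (simp add: D_def central_def)
  have comm: "S i j * S' k l = S' k l * S i j"
    if "i < n" "j < n" and kl: "k < n" "l < n" and "S \<in> {c, p}" "S' \<in> {cb, pb}" for i j k l S S'
  proof -
    have mem: "c i j \<in> elements_mat C \<union> elements_mat Q" "p i j \<in> elements_mat C \<union> elements_mat Q"
      if "i < n" "j < n" for i j
      using elements_matI[OF C that refl] elements_matI[OF Q that refl] by (simp_all add: c_def p_def)
    have "S i j \<in> elements_mat C \<union> elements_mat Q"
      using mem[OF that(1,2)] that(5) by blast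
    moreover have "S' k l = bar (c k l) \<or> S' k l = bar (p k l)"
      using that(6) by (auto simp: c_def p_def cb_def pb_def)
    then obtain b where "b \<in> elements_mat C \<union> elements_mat Q" "S' k l = bar b"
      using mem[OF kl] by blast
    ultimately show ?thesis
      using assms(5)[of "S i j" b] by (simp add: commutator_def)
  qed
  have Z: "col_det (C + Q * mat_diag n (\<lambda>m. d (n - m))) = ?Z"
    using C Q by (simp add: col_det_plus_diag c_def p_def D_def)
  have "col_det (map_mat bar C + map_mat bar Q * mat_diag n (\<lambda>m. d (n - m))) =
      cdet n (\<lambda>i m. map_mat bar C $$ (i, m) + map_mat bar Q $$ (i, m) * D m)"
    using C Q by (simp add: col_det_plus_diag D_def)
  also have "\<dots> = ?Y"
    using C Q by (intro cdet_cong) (simp add: cb_def pb_def)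
  finally have Y: "col_det (map_mat bar C + map_mat bar Q * mat_diag n (\<lambda>m. d (n - m))) = ?Y" .
  \<comment> \<open>Both signs of \<open>u\<close> at once: \<open>c', p'\<close> are \<open>A + uB, E + uF\<close>, and \<open>cb', pb'\<close> are \<open>A - uB, E - uF\<close>.\<close>
  have big: "col_det (map_mat of_base (realify C) + map_mat of_base (realify Q) * shift_mat scale u n d) =
      cdet n (\<lambda>i m. c' i m + p' i m * D m) * cdet n (\<lambda>i m. cb' i m + pb' i m * D m)"
    if u: "u * u = - 1" "\<And>x. u * x = x * u"
      and "\<And>i j. c' i j = of_base (re (C $$ (i, j))) + u * of_base (im (C $$ (i, j)))"
        "\<And>i j. p' i j = of_base (re (Q $$ (i, j))) + u * of_base (im (Q $$ (i, j)))"
        "\<And>i j. cb' i j = of_base (re (C $$ (i, j))) - u * of_base (im (C $$ (i, j)))"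
        "\<And>i j. pb' i j = of_base (re (Q $$ (i, j))) - u * of_base (im (Q $$ (i, j)))"
      and "\<And>i j k l S S'. i < n \<Longrightarrow> j < n \<Longrightarrow> k < n \<Longrightarrow> l < n \<Longrightarrow> S \<in> {c', p'} \<Longrightarrow> S' \<in> {cb', pb'} \<Longrightarrow>
        S i j * S' k l = S' k l * S i j"
      and "\<And>i j k. i < n \<Longrightarrow> j < n \<Longrightarrow> k < n \<Longrightarrow>
        commutator (c' i k) (c' j k) = c' i k * p' j k - c' j k * p' i k"
      and "\<And>i j k. i < n \<Longrightarrow> j < n \<Longrightarrow> k < n \<Longrightarrow>
        commutator (c' i k) (p' j k) = commutator (c' j k) (p' i k)"
      and "\<And>i j k. i < n \<Longrightarrow> j < n \<Longrightarrow> k < n \<Longrightarrow> commutator (p' i k) (p' j k) = 0"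
    for u c' p' cb' pb'
  proof -
    let ?M = "map_mat of_base (realify C) + map_mat of_base (realify Q) * shift_mat scale u n d"
    have "dim_col ?M = 2 * n"
      using shift_mat_carrier[of scale u n d] by simp
    then have "col_det ?M = cdet (2 * n) (\<lambda>r c. ?M $$ (r, c))"
      by (simp add: col_det_eq_cdet)
    also have "\<dots> = cdet (2 * n) (doubled_entry u ?q
        (\<lambda>i j. of_base (re (C $$ (i, j)))) (\<lambda>i j. of_base (im (C $$ (i, j))))
        (\<lambda>i j. of_base (re (Q $$ (i, j)))) (\<lambda>i j. of_base (im (Q $$ (i, j)))) D)"
      unfolding D_def by (rule cdet_cong) (rule realify_plus_shift_index[OF C Q])
    also have "\<dots> = cdet n (\<lambda>i m. c' i m + p' i m * D m) * cdet n (\<lambda>i m. cb' i m + pb' i m * D m)"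
      by (rule cdet_doubled_factorization;
          (rule u scalar_central[OF assms(2)] four_quarters[OF assms(2,1)] D that(3-10); assumption))
    finally show ?thesis .
  qed
  have parts: "c i j = of_base (re (C $$ (i, j))) + imag_unit * of_base (im (C $$ (i, j)))"
      "p i j = of_base (re (Q $$ (i, j))) + imag_unit * of_base (im (Q $$ (i, j)))"
      "cb i j = of_base (re (C $$ (i, j))) - imag_unit * of_base (im (C $$ (i, j)))"
      "pb i j = of_base (re (Q $$ (i, j))) - imag_unit * of_base (im (Q $$ (i, j)))" for i j
    unfolding c_def p_def cb_def pb_def by (rule cplx_eq_re_im bar_eq_re_im)+
  have rels: "commutator (c i k) (c j k) = c i k * p j k - c j k * p i k"
      "commutator (c i k) (p j k) = commutator (c j k) (p i k)"
      "commutator (p i k) (p j k) = 0"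
    if "i < n" "j < n" "k < n" for i j k
    unfolding c_def p_def by (rule cc cp pp; fact that)+
  have "col_det (map_mat of_base (realify C) +
      map_mat of_base (realify Q) * shift_mat scale imag_unit n d) = ?Z * ?Y"
    by (rule big; (rule imag_unit_squared imag_unit_commute parts comm rels; assumption))
  moreover have "col_det (map_mat of_base (realify C) +
      map_mat of_base (realify Q) * shift_mat scale (- imag_unit) n d) = ?Y * ?Z"
  proof (rule big)
    show "- imag_unit * - imag_unit = (- 1 :: 'a cplx)"
      by (simp add: imag_unit_squared)
    show "- imag_unit * x = x * - imag_unit" for x :: "'a cplx"
      using imag_unit_commute[of x] by simp
    show "cb i j = of_base (re (C $$ (i, j))) + - imag_unit * of_base (im (C $$ (i, j)))"
      "pb i j = of_base (re (Q $$ (i, j))) + - imag_unit * of_base (im (Q $$ (i, j)))"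
      "c i j = of_base (re (C $$ (i, j))) - - imag_unit * of_base (im (C $$ (i, j)))"
      "p i j = of_base (re (Q $$ (i, j))) - - imag_unit * of_base (im (Q $$ (i, j)))" for i j
      by (simp_all add: parts)
    show "S i j * S' k l = S' k l * S i j"
      if "i < n" "j < n" "k < n" "l < n" "S \<in> {cb, pb}" "S' \<in> {c, p}" for i j k l S S'
      by (rule comm[symmetric]) (use that in auto)
    fix i j k assume ijk: "i < n" "j < n" "k < n"
    show "commutator (cb i k) (cb j k) = cb i k * pb j k - cb j k * pb i k"
      "commutator (cb i k) (pb j k) = commutator (cb j k) (pb i k)"
      "commutator (pb i k) (pb j k) = 0"
      using rels[OF ijk, THEN arg_cong[where f = bar]]
      by (simp_all add: c_def p_def cb_def pb_def bar_commutator bar_diff bar_mult bar_zero)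
  qed
  moreover have "?Y * ?Z = ?Z * ?Y"
    by (intro cdet_commute commute_linear_combination[symmetric] D; (rule comm; simp | assumption))
  ultimately show ?thesis
    unfolding Z Y by simp
qed

end
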